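(* Let $N$ be prime and $1\leqslant m\leqslant N$. For every $a>0$, \[ \mathbb{P}\big(|D^3(B_m)|>a\big)\leqslant(Nm+1)\exp\left(-\frac{a}{9m}\right). \]
   Context: A $3$-progression in $\mathbb{Z}/N\mathbb{Z}$ is a set $\{x,x+d,x+2d\}$ with $x\in\mathbb{Z}/N\mathbb{Z}$, $d\in\{1,\dots,(N-1)/2\}$. $B_m$ is a uniformly random $m$-element subset of $\mathbb{Z}/N\mathbb{Z}$, $N^3(B_m)$ is the number of $3$-progressions contained in $B_m$, and $D^3(B_m)=N^3(B_m)-\mathbb{E}[N^3(B_m)]$. *)

theory Defs
  imports "HOL-Probability.Probability" "HOL-Computational_Algebra.Primes"
begin

text \<open>Residues modulo \<open>N\<close> are represented by \<open>{0..<N}\<close>. Progressions are counted as sets,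
  so for \<open>N = 3\<close> the three choices of \<open>x\<close> give a single progression; for \<open>N = 2\<close> the range
  \<open>{1..(N - 1) div 2}\<close> is empty, as is the set of integers between \<open>1\<close> and \<open>1/2\<close>.\<close>

definition three_progressions :: "nat \<Rightarrow> nat set set" where
  "three_progressions N =
     {{x, (x + d) mod N, (x + 2 * d) mod N} | x d. x \<in> {0..<N} \<and> d \<in> {1..(N - 1) div 2}}"

definition random_subset :: "nat \<Rightarrow> nat \<Rightarrow> nat set pmf" where
  "random_subset N m = pmf_of_set {B. B \<subseteq> {0..<N} \<and> card B = m}"

definition N3 :: "nat \<Rightarrow> nat set \<Rightarrow> nat" where
  "N3 N B = card {P \<in> three_progressions N. P \<subseteq> B}"

definition D3 :: "nat \<Rightarrow> nat \<Rightarrow> nat set \<Rightarrow> real" where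
  "D3 N m B = real (N3 N B) - measure_pmf.expectation (random_subset N m) (\<lambda>B'. real (N3 N B'))"

end

theory Submission
  imports Defs
begin

text \<open>
  Build \<open>B\<^sub>m\<close> by adding uniformly random new points one at a time. For prime \<open>N > 3\<close> every two
  residues lie in exactly three progressions, so the expected number of progressions completed by
  the next point is an affine function of the number already present. Hence the deviation is
  multiplied in conditional mean by \<open>1 - 3/(N - i)\<close>, which lies in \<open>[-1, 1]\<close> as long as
  \<open>i \<le> N - 2\<close>, and an Azuma--Hoeffding argument applies.
  Its increments are controlled by the numbers of progressions that the candidate points \<open>x\<close> would
  complete. For fixed \<open>x\<close> this counts edges of a 3-regular graph inside a random set, and the same
  argument, now with increments in an interval of length 3, shows that it is within \<open>sqrt a\<close> of a
  mean independent of \<open>x\<close>, except with probability \<open>2 exp (- 2a/(9m))\<close>. A union bound over the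
  points and the steps produces the factor \<open>Nm\<close>; the factors 2 are absorbed since
  \<open>exp (- a/(9m)) \<le> 1/2\<close> unless the claimed bound exceeds 1.
\<close>

section \<open>Averages over the subsets of a given size\<close>

text \<open>Finite sums in place of pmf integrals keep the inductions on the size elementary;
  \<open>expectation_uniform_subset\<close> links the two.\<close>

definition subset_mean :: "'a set \<Rightarrow> nat \<Rightarrow> ('a set \<Rightarrow> real) \<Rightarrow> real" where
  "subset_mean V i g = (\<Sum>B | B \<subseteq> V \<and> card B = i. g B) / real (card V choose i)"

text \<open>Double counting: an \<open>i\<close>-set with a new point outside it is the same as a
  \<open>Suc i\<close>-set with a marked element. So a uniform \<open>Suc i\<close>-set arises from
  a uniform \<open>i\<close>-set by adding a uniform new point.\<close>

lemma subset_mean_Suc: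
  assumes "finite V" "i < card V"
  shows "subset_mean V (Suc i) g =
    subset_mean V i (\<lambda>B. (\<Sum>x\<in>V - B. g (insert x B)) / real (card V - card B))"
proof -
  have fB: "finite B" if "B \<subseteq> V" for B using that assms(1) finite_subset by blast
  have "(\<Sum>B | B \<subseteq> V \<and> card B = i. \<Sum>x\<in>V - B. g (insert x B))
      = (\<Sum>(B, x)\<in>(SIGMA B:{B. B \<subseteq> V \<and> card B = i}. V - B). g (insert x B))"
    using assms(1) by (subst sum.Sigma) auto
  also have "\<dots> = (\<Sum>(C, x)\<in>(SIGMA C:{C. C \<subseteq> V \<and> card C = Suc i}. C). g C)"
    by (rule sum.reindex_bij_witness[where i = "\<lambda>(C, x). (C - {x}, x)" and j = "\<lambda>(B, x). (insert x B, x)"])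
       (auto simp: insert_absorb card_insert_if fB)
  also have "\<dots> = (\<Sum>C | C \<subseteq> V \<and> card C = Suc i. \<Sum>x\<in>C. g C)"
    using assms(1) fB by (subst sum.Sigma) auto
  also have "\<dots> = real (Suc i) * (\<Sum>C | C \<subseteq> V \<and> card C = Suc i. g C)"
    by (simp add: sum_distrib_left)
  finally have eq: "(\<Sum>B | B \<subseteq> V \<and> card B = i. \<Sum>x\<in>V - B. g (insert x B)) =
    real (Suc i) * (\<Sum>C | C \<subseteq> V \<and> card C = Suc i. g C)" .
  have "Suc i * (card V choose Suc i) = (card V choose i) * (card V - i)"
    using assms(2) by (metis Suc_times_binomial_eq binomial_absorb_comp binomial_absorption mult.commute)
  then have "real (Suc i) * real (card V choose Suc i) = real (card V choose i) * real (card V - i)"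
    by (metis of_nat_mult)
  moreover have "subset_mean V i (\<lambda>B. (\<Sum>x\<in>V - B. g (insert x B)) / real (card V - card B))
     = (\<Sum>B | B \<subseteq> V \<and> card B = i. \<Sum>x\<in>V - B. g (insert x B)) / real (card V - i) / real (card V choose i)"
    unfolding subset_mean_def sum_divide_distrib by (intro sum.cong) auto
  ultimately have "subset_mean V i (\<lambda>B. (\<Sum>x\<in>V - B. g (insert x B)) / real (card V - card B))
     = real (Suc i) * (\<Sum>C | C \<subseteq> V \<and> card C = Suc i. g C) / (real (Suc i) * real (card V choose Suc i))"
    unfolding eq by (simp only: divide_divide_eq_left mult.commute[of "real (card V - i)"])
  then show ?thesis by (simp add: subset_mean_def del: of_nat_Suc)
qed

lemma subset_mean_mono:
  assumes "\<And>B. B \<subseteq> V \<Longrightarrow> card B = i \<Longrightarrow> g B \<le> h B"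
  shows "subset_mean V i g \<le> subset_mean V i h"
  unfolding subset_mean_def by (intro divide_right_mono sum_mono) (use assms in auto)

lemma subset_mean_cong:
  assumes "\<And>B. B \<subseteq> V \<Longrightarrow> card B = i \<Longrightarrow> g B = h B"
  shows "subset_mean V i g = subset_mean V i h"
  unfolding subset_mean_def using assms by (intro arg_cong2[where f="(/)"] sum.cong) auto

lemma subset_mean_add:
  "subset_mean V i (\<lambda>B. g B + h B) = subset_mean V i g + subset_mean V i h"
  by (simp add: subset_mean_def sum.distrib add_divide_distrib)

lemma subset_mean_cmult: "subset_mean V i (\<lambda>B. c * g B) = c * subset_mean V i g"
  by (simp add: subset_mean_def sum_distrib_left)

lemma subset_mean_sum:
  "subset_mean V i (\<lambda>B. \<Sum>x\<in>S. g x B) = (\<Sum>x\<in>S. subset_mean V i (g x))"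
  unfolding subset_mean_def sum_divide_distrib by (rule sum.swap)

lemma subset_mean_const: "finite V \<Longrightarrow> i \<le> card V \<Longrightarrow> subset_mean V i (\<lambda>_. c) = c"
  by (simp add: subset_mean_def n_subsets)

lemma subset_mean_0: "finite V \<Longrightarrow> subset_mean V 0 g = g {}"
proof -
  assume "finite V"
  then have "{B. B \<subseteq> V \<and> card B = 0} = {{}}" by (auto dest: finite_subset)
  then show ?thesis by (simp add: subset_mean_def)
qed

lemma expectation_uniform_subset:
  assumes "finite V" "i \<le> card V"
  shows "measure_pmf.expectation (pmf_of_set {B. B \<subseteq> V \<and> card B = i}) g = subset_mean V i g"
proof -
  have "card {B. B \<subseteq> V \<and> card B = i} = card V choose i" using assms n_subsets by blast
  moreover have "card V choose i > 0" using assms by simp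
  ultimately have "{B. B \<subseteq> V \<and> card B = i} \<noteq> {}" by fastforce
  then show ?thesis
    using assms by (subst integral_pmf_of_set) (auto simp: subset_mean_def n_subsets)
qed

section \<open>Exponential moments and the Azuma--Hoeffding bound\<close>

text \<open>Hoeffding's lemma for a uniform point of \<open>S\<close>. The range is bounded through
  pairwise differences because later only the counts of two candidate points are compared, with no
  interval given in advance.\<close>

lemma mean_exp_le_Hoeffding:
  fixes h :: "'a \<Rightarrow> real"
  assumes "finite S" "S \<noteq> {}" and range: "\<And>x y. x \<in> S \<Longrightarrow> y \<in> S \<Longrightarrow> h x - h y \<le> r"
  shows "(\<Sum>x\<in>S. exp (l * h x)) / card S
    \<le> exp (l * ((\<Sum>x\<in>S. h x) / card S)) * exp (l\<^sup>2 * r\<^sup>2 / 8)"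
proof -
  let ?p = "pmf_of_set S"
  \<comment> \<open>Hoeffding's lemma asks for a positive parameter. Stating this for arbitrary
    \<open>h\<close> and \<open>l > 0\<close> lets negative \<open>l\<close> be handled by passing
    to \<open>- h\<close> and \<open>- l\<close>.\<close>
  have pos: "(\<Sum>x\<in>S. exp (l * h x)) / card S
    \<le> exp (l * ((\<Sum>x\<in>S. h x) / card S)) * exp (l\<^sup>2 * r\<^sup>2 / 8)"
    if range: "\<And>x y. x \<in> S \<Longrightarrow> y \<in> S \<Longrightarrow> h x - h y \<le> r" and "l > 0" for h :: "'a \<Rightarrow> real" and l :: real
  proof -
    define lo where "lo = Min (h ` S)"
    have lo: "lo \<in> h ` S" unfolding lo_def using assms by (intro Min_in) auto
    then have bd: "h x \<in> {lo..lo + r}" if "x \<in> S" for x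
    proof -
      from lo obtain y where "y \<in> S" "lo = h y" by auto
      moreover have "lo \<le> h x" unfolding lo_def using assms(1) that by simp
      ultimately show ?thesis using range[of x y] that by simp
    qed
    define \<mu> where "\<mu> = (\<Sum>x\<in>S. h x) / card S"
    have mu: "measure_pmf.expectation ?p h = \<mu>"
      using assms(1,2) by (simp add: \<mu>_def integral_pmf_of_set)
    have "AE x in ?p. h x \<in> {lo..lo + r}"
      by (intro AE_pmfI bd) (simp add: set_pmf_of_set[OF assms(2,1)])
    then interpret interval_bounded_random_variable ?p h lo "lo + r"
      by unfold_locales auto
    have "(\<integral>\<^sup>+x. exp (l * (h x - \<mu>)) \<partial>?p) \<le> ennreal (exp (l\<^sup>2 * r\<^sup>2 / 8))"
      using Hoeffdings_lemma_nn_integral[OF \<open>l > 0\<close>] by (simp add: mu)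
    moreover have "(\<integral>\<^sup>+x. exp (l * (h x - \<mu>)) \<partial>?p) = ennreal (measure_pmf.expectation ?p (\<lambda>x. exp (l * (h x - \<mu>))))"
      by (intro nn_integral_eq_integral integrable_measure_pmf_finite) (simp_all add: set_pmf_of_set[OF assms(2,1)] assms(1))
    ultimately have "measure_pmf.expectation ?p (\<lambda>x. exp (l * (h x - \<mu>))) \<le> exp (l\<^sup>2 * r\<^sup>2 / 8)"
      by simp
    also have "measure_pmf.expectation ?p (\<lambda>x. exp (l * (h x - \<mu>)))
      = (\<Sum>x\<in>S. exp (l * h x)) / card S / exp (l * \<mu>)"
      using assms(1,2)
      by (simp add: integral_pmf_of_set right_diff_distrib exp_diff sum_divide_distrib field_simps)
    finally have "(\<Sum>x\<in>S. exp (l * h x)) / card S \<le> exp (l\<^sup>2 * r\<^sup>2 / 8) * exp (l * \<mu>)"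
      by (subst (asm) pos_divide_le_eq) simp_all
    then show ?thesis by (simp only: \<mu>_def mult.commute)
  qed
  consider "l > 0" | "l = 0" | "l < 0" by linarith
  then show ?thesis
  proof cases
    case 2
    then show ?thesis using assms(1,2) by simp
  next
    case 3
    have "- h x - - h y \<le> r" if "x \<in> S" "y \<in> S" for x y using range[of y x] that by simp
    from pos[where h = "\<lambda>x. - h x" and l = "- l", OF this] 3 show ?thesis by (simp add: sum_negf)
  qed (rule pos[OF range])
qed

text \<open>Averaging \<open>g\<close> over the last point gives a function with a bound of the same shape, where \<open>l\<close> is
  multiplied by the contraction factor; bad sets are charged to the error term at the step where
  they occur. So no joint law of the whole trajectory is needed.\<close>

lemma subset_mean_le_of_exp_bound:
  assumes "finite V" "i \<le> card V" "f {} = 0" "K \<ge> 0"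
    and mart: "\<And>B. B \<subseteq> V \<Longrightarrow> card B < i \<Longrightarrow>
      (\<Sum>x\<in>V - B. f (insert x B)) / real (card V - card B) = c (card B) * f B"
    and contr: "\<And>j. j < i \<Longrightarrow> \<bar>c j\<bar> \<le> 1"
    and range: "\<And>B x y. B \<subseteq> V \<Longrightarrow> card B < i \<Longrightarrow> B \<notin> bad \<Longrightarrow> x \<in> V - B \<Longrightarrow> y \<in> V - B \<Longrightarrow>
      f (insert x B) - f (insert y B) \<le> r"
    and g1: "\<And>B. B \<subseteq> V \<Longrightarrow> card B = i \<Longrightarrow> g B \<le> 1"
    and gK: "\<And>B. B \<subseteq> V \<Longrightarrow> card B = i \<Longrightarrow> g B \<le> K * (exp (l * f B) + exp (- l * f B))"
  shows "subset_mean V i g \<le> 2 * K * exp (i * (l\<^sup>2 * r\<^sup>2 / 8)) + (\<Sum>j<i. subset_mean V j (indicator bad))"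
  using assms(2) mart contr range g1 gK \<open>K \<ge> 0\<close>
proof (induction i arbitrary: g l K)
  case 0
  then show ?case using assms(1,3) "0.prems"(6)[of "{}"] by (simp add: subset_mean_0)
next
  case (Suc i)
  \<comment> \<open>\<open>T\<close> averages out the last point. \<open>g'\<close> drops the bad
    sets, which costs at most their frequency because \<open>T\<close> never exceeds 1.\<close>
  define T where "T B = (\<Sum>x\<in>V - B. g (insert x B)) / real (card V - card B)" for B
  define g' where "g' B = (if B \<in> bad then 0 else T B)" for B
  have fin: "finite B" "finite (V - B)" if "B \<subseteq> V" for B using that assms(1) finite_subset by auto
  have ins: "insert x B \<subseteq> V" "card (insert x B) = Suc i" if "B \<subseteq> V" "card B = i" "x \<in> V - B" for B x
    using that fin by auto
  have cdiff: "card (V - B) = card V - card B" "V - B \<noteq> {}" if "B \<subseteq> V" "card B = i" for B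
    using that fin Suc.prems(1) by (auto simp: card_Diff_subset)
  have T1: "T B \<le> 1" if B: "B \<subseteq> V" "card B = i" for B
  proof -
    have "(\<Sum>x\<in>V - B. g (insert x B)) \<le> (\<Sum>x\<in>V - B. 1)"
      using ins[OF B] by (intro sum_mono Suc.prems(5)) auto
    then show ?thesis using B cdiff[OF B] Suc.prems(1) unfolding T_def by (simp add: divide_le_eq)
  qed
  let ?H = "exp (l\<^sup>2 * r\<^sup>2 / 8)"
  have TK: "T B \<le> K * ?H * (exp (l * c i * f B) + exp (- (l * c i) * f B))"
    if B: "B \<subseteq> V" "card B = i" "B \<notin> bad" for B
  proof -
    have "T B \<le> (\<Sum>x\<in>V - B. K * (exp (l * f (insert x B)) + exp (- l * f (insert x B)))) / card (V - B)"
      unfolding T_def cdiff(1)[OF B(1,2)] using ins[OF B(1,2)]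
      by (intro divide_right_mono sum_mono Suc.prems(6)) auto
    also have "\<dots> = K * ((\<Sum>x\<in>V - B. exp (l * f (insert x B))) / card (V - B) +
        (\<Sum>x\<in>V - B. exp (- l * f (insert x B))) / card (V - B))"
      by (simp add: sum_distrib_left[symmetric] sum.distrib add_divide_distrib distrib_left)
    also have "\<dots> \<le> K * (exp (l * (c i * f B)) * ?H + exp (- l * (c i * f B)) * exp ((- l)\<^sup>2 * r\<^sup>2 / 8))"
    proof (intro mult_left_mono add_mono)
      have "(\<Sum>x\<in>V - B. exp (s * f (insert x B))) / card (V - B) \<le> exp (s * (c i * f B)) * exp (s\<^sup>2 * r\<^sup>2 / 8)" for s
      proof -
        have "(\<Sum>x\<in>V - B. f (insert x B)) / card (V - B) = c i * f B"
          using Suc.prems(2)[of B] cdiff(1)[OF B(1,2)] B by simp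
        moreover have "(\<Sum>x\<in>V - B. exp (s * f (insert x B))) / card (V - B)
            \<le> exp (s * ((\<Sum>x\<in>V - B. f (insert x B)) / card (V - B))) * exp (s\<^sup>2 * r\<^sup>2 / 8)"
          using fin[OF B(1)] cdiff[OF B(1,2)] Suc.prems(4)[of B] B by (intro mean_exp_le_Hoeffding) auto
        ultimately show ?thesis by (simp only:)
      qed
      then show "(\<Sum>x\<in>V - B. exp (l * f (insert x B))) / card (V - B) \<le> exp (l * (c i * f B)) * ?H"
        "(\<Sum>x\<in>V - B. exp (- l * f (insert x B))) / card (V - B) \<le> exp (- l * (c i * f B)) * exp ((- l)\<^sup>2 * r\<^sup>2 / 8)"
        by blast+
    qed (use \<open>K \<ge> 0\<close> in auto)
    finally show ?thesis by (simp add: algebra_simps)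
  qed
  have "subset_mean V (Suc i) g = subset_mean V i T"
    unfolding T_def using assms(1) Suc.prems(1) by (intro subset_mean_Suc) auto
  also have "\<dots> \<le> subset_mean V i (\<lambda>B. g' B + indicator bad B)"
    by (rule subset_mean_mono) (auto simp: g'_def T1)
  also have "\<dots> = subset_mean V i g' + subset_mean V i (indicator bad)"
    by (rule subset_mean_add)
  \<comment> \<open>The induction hypothesis is taken with \<open>l * c i\<close> for
    \<open>l\<close> and \<open>K * ?H\<close> for \<open>K\<close>. A negative \<open>c i\<close>
    only swaps the two exponentials, which is why the bound on \<open>g\<close> is symmetric in the
    sign of \<open>l\<close>.\<close>
  also have "subset_mean V i g' \<le> 2 * (K * ?H) * exp (i * ((l * c i)\<^sup>2 * r\<^sup>2 / 8))
      + (\<Sum>j<i. subset_mean V j (indicator bad))"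
  proof (rule Suc.IH)
    show "g' B \<le> 1" if "B \<subseteq> V" "card B = i" for B using T1 that by (auto simp: g'_def)
    show "g' B \<le> K * ?H * (exp (l * c i * f B) + exp (- (l * c i) * f B))" if "B \<subseteq> V" "card B = i" for B
      using TK[OF that] \<open>K \<ge> 0\<close> by (auto simp: g'_def)
  qed (use Suc.prems in auto)
  \<comment> \<open>The contraction only shrinks the parameter, so \<open>l * c i\<close> may be
    replaced by \<open>l\<close> again.\<close>
  also have "2 * (K * ?H) * exp (i * ((l * c i)\<^sup>2 * r\<^sup>2 / 8)) \<le> 2 * (K * ?H) * exp (i * (l\<^sup>2 * r\<^sup>2 / 8))"
  proof -
    have "(c i)\<^sup>2 \<le> 1" using Suc.prems(3)[of i] by (simp add: abs_square_le_1)
    then have "(l * c i)\<^sup>2 \<le> l\<^sup>2" by (simp add: power_mult_distrib mult_left_le)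
    then show ?thesis using \<open>K \<ge> 0\<close> by (intro mult_left_mono) (auto intro!: mult_left_mono mult_right_mono divide_right_mono)
  qed
  also have "2 * (K * ?H) * exp (i * (l\<^sup>2 * r\<^sup>2 / 8)) = 2 * K * exp (Suc i * (l\<^sup>2 * r\<^sup>2 / 8))"
    by (simp add: exp_add[symmetric] algebra_simps)
  finally show ?case by simp
qed

text \<open>Chernoff's method: the indicator of a large deviation is dominated by a multiple of the
  two exponentials.\<close>

lemma subset_mean_tail:
  assumes "finite V" "i \<le> card V" "f {} = 0" "r > 0"
    and mart: "\<And>B. B \<subseteq> V \<Longrightarrow> card B < i \<Longrightarrow>
      (\<Sum>x\<in>V - B. f (insert x B)) / real (card V - card B) = c (card B) * f B"
    and contr: "\<And>j. j < i \<Longrightarrow> \<bar>c j\<bar> \<le> 1"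
    and range: "\<And>B x y. B \<subseteq> V \<Longrightarrow> card B < i \<Longrightarrow> B \<notin> bad \<Longrightarrow> x \<in> V - B \<Longrightarrow> y \<in> V - B \<Longrightarrow>
      f (insert x B) - f (insert y B) \<le> r"
    and "a \<ge> 0"
  shows "subset_mean V i (indicator {B. \<bar>f B\<bar> > a})
    \<le> 2 * exp (- (2 * a\<^sup>2 / (i * r\<^sup>2))) + (\<Sum>j<i. subset_mean V j (indicator bad))"
proof -
  \<comment> \<open>This minimises the exponent \<open>- l * a + i * l^2 * r^2 / 8\<close>. For
    \<open>i = 0\<close> it is 0 by division by zero, and the exponential term of the bound becomes
    2.\<close>
  define l where "l = 4 * a / (i * r\<^sup>2)"
  have l: "l \<ge> 0" unfolding l_def using assms by simp
  have "subset_mean V i (indicator {B. \<bar>f B\<bar> > a}) \<le> 2 * exp (- (l * a)) * exp (i * (l\<^sup>2 * r\<^sup>2 / 8)) + (\<Sum>j<i. subset_mean V j (indicator bad))"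
  proof (rule subset_mean_le_of_exp_bound[OF assms(1-3) _ mart contr range])
    show "indicator {B. \<bar>f B\<bar> > a} B \<le> exp (- (l * a)) * (exp (l * f B) + exp (- l * f B))" for B
    proof (cases "\<bar>f B\<bar> > a")
      case True
      have "exp (l * a) \<le> exp (l * \<bar>f B\<bar>)" using True l by (simp add: mult_left_mono)
      also have "\<dots> \<le> exp (l * f B) + exp (- l * f B)" by (cases "f B \<ge> 0") auto
      finally show ?thesis using True by (simp add: exp_minus field_simps)
    qed auto
  qed (auto simp: indicator_def)
  also have "2 * exp (- (l * a)) * exp (i * (l\<^sup>2 * r\<^sup>2 / 8)) = 2 * exp (- (2 * a\<^sup>2 / (i * r\<^sup>2)))"
  proof -
    have "- (l * a) + i * (l\<^sup>2 * r\<^sup>2 / 8) = - (2 * a\<^sup>2 / (i * r\<^sup>2))"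
      using \<open>r > 0\<close> by (cases "i = 0") (simp_all add: l_def field_simps power2_eq_square)
    then show ?thesis by (simp add: exp_add[symmetric] mult.assoc)
  qed
  finally show ?thesis .
qed

section \<open>Blocks of a design in a random set\<close>

lemma sum_card_Collect_swap:
  assumes "finite A" "finite B"
  shows "(\<Sum>x\<in>A. card {y \<in> B. R x y}) = (\<Sum>y\<in>B. card {x \<in> A. R x y})"
proof -
  have "(\<Sum>x\<in>A. card {y \<in> B. R x y}) = (\<Sum>x\<in>A. \<Sum>y\<in>B. if R x y then 1 else 0)"
    using assms by (intro sum.cong) (simp_all add: sum.If_cases Int_def)
  also have "\<dots> = (\<Sum>y\<in>B. \<Sum>x\<in>A. if R x y then 1 else 0)" by (rule sum.swap)
  also have "\<dots> = (\<Sum>y\<in>B. card {x \<in> A. R x y})"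
    using assms by (intro sum.cong) (simp_all add: sum.If_cases Int_def)
  finally show ?thesis .
qed

definition inner_blocks :: "'a set set \<Rightarrow> 'a set \<Rightarrow> real" where
  "inner_blocks F B = real (card {P \<in> F. P \<subseteq> B})"

text \<open>The derived design at \<open>x\<close>: adding \<open>x\<close> to \<open>B\<close>
  completes exactly the blocks whose remainder lies in \<open>B\<close>.\<close>

definition link :: "'a set set \<Rightarrow> 'a \<Rightarrow> 'a set set" where
  "link F x = (\<lambda>P. P - {x}) ` {P \<in> F. x \<in> P}"

text \<open>Designs with parameters \<open>k-(card V, k + 1, r)\<close>.\<close>

locale block_design =
  fixes V :: "'a set" and F :: "'a set set" and k r :: nat
  assumes finite_V: "finite V"
    and block: "P \<in> F \<Longrightarrow> P \<subseteq> V \<and> card P = Suc k"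
    and codegree: "S \<subseteq> V \<Longrightarrow> card S = k \<Longrightarrow> card {P \<in> F. S \<subseteq> P} = r"
begin

lemma finite_F: "finite F"
  using finite_V block by (intro finite_subset[of F "Pow V"]) auto

lemma inner_blocks_insert:
  assumes "x \<notin> B"
  shows "inner_blocks F (insert x B) = inner_blocks F B + inner_blocks (link F x) B"
proof -
  have "{P \<in> F. P \<subseteq> insert x B} = {P \<in> F. P \<subseteq> B} \<union> {P \<in> F. x \<in> P \<and> P \<subseteq> insert x B}"
    by auto
  moreover have "{P \<in> F. P \<subseteq> B} \<inter> {P \<in> F. x \<in> P \<and> P \<subseteq> insert x B} = {}"
    using assms by auto
  moreover have "{P \<in> link F x. P \<subseteq> B} = (\<lambda>P. P - {x}) ` {P \<in> F. x \<in> P \<and> P \<subseteq> insert x B}"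
    by (auto simp: link_def)
  moreover have "inj_on (\<lambda>P. P - {x}) {P \<in> F. x \<in> P \<and> P \<subseteq> insert x B}"
    by (auto simp: inj_on_def)
  ultimately show ?thesis
    using finite_F by (simp add: inner_blocks_def card_Un_disjoint card_image)
qed

text \<open>Removing \<open>x\<close> is injective on the blocks through \<open>x\<close>, so
  codegrees survive. This permits descent in \<open>k\<close>: links of triple systems are regular
  graphs, links of graphs are families of singletons.\<close>

lemma link_design:
  assumes "x \<in> V" "k = Suc k'"
  shows "block_design (V - {x}) (link F x) k' r"
proof
  show "finite (V - {x})" using finite_V by simp
next
  fix P assume "P \<in> link F x"
  then show "P \<subseteq> V - {x} \<and> card P = Suc k'"
    using block assms by (auto simp: link_def)
next
  fix S assume S: "S \<subseteq> V - {x}" "card S = k'"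
  have fS: "finite S" using S(1) finite_V finite_subset by blast
  have "{P \<in> link F x. S \<subseteq> P} = (\<lambda>P. P - {x}) ` {P \<in> F. insert x S \<subseteq> P}"
    using S by (auto simp: link_def)
  moreover have "inj_on (\<lambda>P. P - {x}) {P \<in> F. insert x S \<subseteq> P}"
    by (auto simp: inj_on_def)
  moreover have "card {P \<in> F. insert x S \<subseteq> P} = r"
    using S assms fS by (intro codegree) (auto simp: card_insert_if)
  ultimately show "card {P \<in> link F x. S \<subseteq> P} = r" by (simp add: card_image)
qed

text \<open>Only the number of points of \<open>P\<close> outside \<open>B\<close> matters: the
  binomial is \<open>Suc k\<close> for none, 1 for exactly one, and 0 for more. The correction term
  for blocks already inside \<open>B\<close> makes one formula cover all cases.\<close>

lemma card_completions:
  assumes "B \<subseteq> V" "P \<in> F"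
  shows "card {x \<in> V - B. x \<in> P \<and> P - {x} \<subseteq> B} + (if P \<subseteq> B then Suc k else 0) = card (P \<inter> B) choose k"
proof (cases "P \<subseteq> B")
  case True
  then have e: "{x \<in> V - B. x \<in> P \<and> P - {x} \<subseteq> B} = {}" "P \<inter> B = P" by auto
  show ?thesis unfolding e using True block[OF assms(2)] by simp
next
  case False
  have fP: "finite P" using block[OF assms(2)] finite_V finite_subset by blast
  have c: "card (P \<inter> B) + card (P - B) = Suc k"
    using block[OF assms(2)] fP by (metis Diff_Int2 Int_commute card_Int_Diff)
  from False fP have "card (P - B) \<noteq> 0" by auto
  then consider "card (P - B) = 1" | "card (P - B) \<ge> 2" by linarith
  then show ?thesis
  proof cases
    case 1
    then obtain x where "P - B = {x}" by (auto simp: card_1_singleton_iff)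
    then have "{x \<in> V - B. x \<in> P \<and> P - {x} \<subseteq> B} = {x}" using block[OF assms(2)] by auto
    then show ?thesis using False c 1 by simp
  next
    case 2
    have e: "{x \<in> V - B. x \<in> P \<and> P - {x} \<subseteq> B} = {}"
    proof (rule ccontr)
      assume "{x \<in> V - B. x \<in> P \<and> P - {x} \<subseteq> B} \<noteq> {}"
      then obtain x where "P - B \<subseteq> {x}" by auto
      then have "card (P - B) \<le> card {x}" by (intro card_mono) auto
      with 2 show False by simp
    qed
    show ?thesis unfolding e using False c 2 by simp
  qed
qed

text \<open>Summing \<open>card_completions\<close> over all blocks counts pairs of a
  \<open>k\<close>-subset of \<open>B\<close> and a block containing it; by the codegree this number
  depends only on the size of \<open>B\<close>. Hence the conditional mean of the next count is
  affine in the present one.\<close>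

lemma sum_inner_blocks_link:
  assumes "B \<subseteq> V"
  shows "(\<Sum>x\<in>V - B. inner_blocks (link F x) B) + real (Suc k) * inner_blocks F B
    = real r * real (card B choose k)"
proof -
  have fB: "finite B" using assms finite_V finite_subset by blast
  have lk: "inner_blocks (link F x) B = real (card {P \<in> F. x \<in> P \<and> P - {x} \<subseteq> B})" for x
  proof -
    have "{P \<in> link F x. P \<subseteq> B} = (\<lambda>P. P - {x}) ` {P \<in> F. x \<in> P \<and> P - {x} \<subseteq> B}"
      by (auto simp: link_def)
    moreover have "inj_on (\<lambda>P. P - {x}) {P \<in> F. x \<in> P \<and> P - {x} \<subseteq> B}"
      by (auto simp: inj_on_def)
    ultimately show ?thesis by (simp add: inner_blocks_def card_image)
  qed
  have sub: "card {S \<in> {S. S \<subseteq> B \<and> card S = k}. S \<subseteq> P} = card (P \<inter> B) choose k" for P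
  proof -
    have "{S \<in> {S. S \<subseteq> B \<and> card S = k}. S \<subseteq> P} = {S. S \<subseteq> P \<inter> B \<and> card S = k}" by auto
    then show ?thesis using fB n_subsets[of "P \<inter> B" k] by simp
  qed
  have "(\<Sum>x\<in>V - B. card {P \<in> F. x \<in> P \<and> P - {x} \<subseteq> B}) + Suc k * card {P \<in> F. P \<subseteq> B}
     = (\<Sum>P\<in>F. card {x \<in> V - B. x \<in> P \<and> P - {x} \<subseteq> B}) + (\<Sum>P\<in>F. if P \<subseteq> B then Suc k else 0)"
    using finite_F finite_V
    by (subst sum_card_Collect_swap) (auto simp: sum.If_cases Int_def)
  also have "\<dots> = (\<Sum>P\<in>F. card (P \<inter> B) choose k)"
    unfolding sum.distrib[symmetric] using card_completions[OF assms] by (intro sum.cong) auto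
  also have "\<dots> = (\<Sum>P\<in>F. card {S \<in> {S. S \<subseteq> B \<and> card S = k}. S \<subseteq> P})"
    by (simp only: sub)
  also have "\<dots> = (\<Sum>S | S \<subseteq> B \<and> card S = k. card {P \<in> F. S \<subseteq> P})"
    using finite_F fB by (subst sum_card_Collect_swap) auto
  also have "\<dots> = (\<Sum>S | S \<subseteq> B \<and> card S = k. r)"
    using assms by (intro sum.cong codegree) auto
  also have "\<dots> = r * (card B choose k)" using fB by (simp add: n_subsets)
  finally have "real ((\<Sum>x\<in>V - B. card {P \<in> F. x \<in> P \<and> P - {x} \<subseteq> B}) + Suc k * card {P \<in> F. P \<subseteq> B}) =
    real (r * (card B choose k))" by (rule arg_cong)
  then show ?thesis unfolding lk by (simp add: inner_blocks_def del: of_nat_Suc mult_Suc)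
qed

end

text \<open>A recursion in the design parameters alone, which makes it evident that the links of all points
  have the same mean.\<close>

primrec block_mean :: "nat \<Rightarrow> nat \<Rightarrow> nat \<Rightarrow> nat \<Rightarrow> real" where
  "block_mean n k r 0 = 0"
| "block_mean n k r (Suc i) = block_mean n k r i +
     (real r * real (i choose k) - real (Suc k) * block_mean n k r i) / real (n - i)"

section \<open>Deviation of the block count from its mean\<close>

context block_design
begin

lemma inner_blocks_empty: "inner_blocks F {} = 0"
proof -
  have "{P \<in> F. P \<subseteq> {}} = {}" using block by fastforce
  then show ?thesis by (simp add: inner_blocks_def)
qed

lemma mean_inner_blocks_insert:
  assumes "B \<subseteq> V" "card B < card V"
  shows "(\<Sum>x\<in>V - B. inner_blocks F (insert x B)) / real (card V - card B) = inner_blocks F B +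
     (real r * real (card B choose k) - real (Suc k) * inner_blocks F B) / real (card V - card B)"
proof -
  have c: "card (V - B) = card V - card B"
    using assms finite_V by (intro card_Diff_subset) (auto dest: finite_subset)
  have "(\<Sum>x\<in>V - B. inner_blocks F (insert x B))
      = (\<Sum>x\<in>V - B. inner_blocks F B + inner_blocks (link F x) B)"
    by (intro sum.cong) (auto simp: inner_blocks_insert)
  also have "\<dots> = real (card V - card B) * inner_blocks F B + (real r * real (card B choose k) - real (Suc k) * inner_blocks F B)"
    unfolding sum.distrib sum_inner_blocks_link[OF assms(1), symmetric] by (simp add: c del: of_nat_diff)
  finally show ?thesis using assms(2) by (simp add: add_divide_distrib del: of_nat_diff of_nat_Suc)
qed

text \<open>An affine conditional mean commutes with averaging, so the mean obeys the recursion of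
  \<open>block_mean\<close>.\<close>

lemma subset_mean_inner_blocks:
  assumes "i \<le> card V"
  shows "subset_mean V i (inner_blocks F) = block_mean (card V) k r i"
  using assms
proof (induction i)
  case 0
  then show ?case by (simp add: subset_mean_0 finite_V inner_blocks_empty)
next
  case (Suc i)
  let ?b = "1 - real (Suc k) / real (card V - i)" and ?d = "real r * real (i choose k) / real (card V - i)"
  have "subset_mean V (Suc i) (inner_blocks F) = subset_mean V i (\<lambda>B. ?b * inner_blocks F B + ?d)"
    unfolding subset_mean_Suc[OF finite_V Suc_le_lessD[OF Suc.prems]]
    using Suc.prems by (intro subset_mean_cong) (auto simp: mean_inner_blocks_insert diff_divide_distrib algebra_simps simp del: of_nat_diff)
  also have "\<dots> = ?b * block_mean (card V) k r i + ?d"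
    using Suc finite_V by (simp add: subset_mean_add subset_mean_cmult subset_mean_const)
  finally show ?case by (simp add: diff_divide_distrib algebra_simps del: of_nat_diff)
qed

text \<open>Centred according to the size of the argument, so that one function describes the
  deviation at every stage of the process.\<close>

definition block_dev :: "'a set \<Rightarrow> real" where
  "block_dev B = inner_blocks F B - block_mean (card V) k r (card B)"

lemma block_dev_empty: "block_dev {} = 0"
  by (simp add: block_dev_def inner_blocks_empty)

text \<open>The inhomogeneous term of the affine recursion cancels against that of
  \<open>block_mean\<close>; only the linear factor remains.\<close>

lemma mean_block_dev_insert:
  assumes "B \<subseteq> V" "card B < card V"
  shows "(\<Sum>x\<in>V - B. block_dev (insert x B)) / real (card V - card B)
    = (1 - real (Suc k) / real (card V - card B)) * block_dev B"
proof -
  have fB: "finite B" using assms finite_V finite_subset by blast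
  have c: "card (V - B) = card V - card B"
    using assms fB by (intro card_Diff_subset) auto
  have "(\<Sum>x\<in>V - B. block_dev (insert x B)) =
     (\<Sum>x\<in>V - B. inner_blocks F (insert x B) - block_mean (card V) k r (Suc (card B)))"
    using fB by (intro sum.cong) (auto simp: block_dev_def)
  also have "\<dots> = (\<Sum>x\<in>V - B. inner_blocks F (insert x B)) - real (card V - card B) * block_mean (card V) k r (Suc (card B))"
    by (simp only: sum_subtractf sum_constant c)
  finally have "(\<Sum>x\<in>V - B. block_dev (insert x B)) / real (card V - card B) =
     (\<Sum>x\<in>V - B. inner_blocks F (insert x B)) / real (card V - card B) - block_mean (card V) k r (Suc (card B))"
    using assms(2) by (simp add: diff_divide_distrib del: of_nat_diff block_mean.simps)
  then show ?thesis unfolding mean_inner_blocks_insert[OF assms] block_mean.simps block_dev_def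
    by (simp add: diff_divide_distrib algebra_simps del: of_nat_diff of_nat_Suc)
qed

text \<open>The centring is the same for two sets of equal size, so increments at two candidates
  differ by their link counts. The second assumption expresses
  \<open>Suc k <= 2 * (card V - j)\<close> at the last step \<open>j = i - 1\<close>, which keeps
  the linear factor at least -1.\<close>

lemma block_dev_tail:
  assumes "i \<le> card V" "Suc k + 2 * i \<le> 2 * card V + 2" "s > 0" "a \<ge> 0"
    and range: "\<And>B x y. B \<subseteq> V \<Longrightarrow> card B < i \<Longrightarrow> B \<notin> bad \<Longrightarrow> x \<in> V - B \<Longrightarrow> y \<in> V - B \<Longrightarrow>
      inner_blocks (link F x) B - inner_blocks (link F y) B \<le> s"
  shows "subset_mean V i (indicator {B. \<bar>block_dev B\<bar> > a})
    \<le> 2 * exp (- (2 * a\<^sup>2 / (i * s\<^sup>2))) + (\<Sum>j<i. subset_mean V j (indicator bad))"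
proof (rule subset_mean_tail[OF finite_V assms(1) block_dev_empty \<open>s > 0\<close> mean_block_dev_insert])
  fix j assume "j < i"
  then have "real (Suc k) \<le> 2 * real (card V - j)" "real (card V - j) > 0"
    using assms(1,2) by linarith+
  then have "real (Suc k) / real (card V - j) \<le> 2" by (simp add: divide_le_eq)
  moreover have "real (Suc k) / real (card V - j) \<ge> 0" by simp
  moreover have "\<bar>1 - z\<bar> \<le> 1" if "z \<le> 2" "0 \<le> z" for z :: real using that by linarith
  ultimately show "\<bar>1 - real (Suc k) / real (card V - j)\<bar> \<le> 1" by blast
next
  fix B x y assume B: "B \<subseteq> V" "card B < i" "B \<notin> bad" "x \<in> V - B" "y \<in> V - B"
  moreover have "finite B" using B finite_V finite_subset by blast
  ultimately show "block_dev (insert x B) - block_dev (insert y B) \<le> s"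
    using range[of B x y] by (simp add: block_dev_def inner_blocks_insert)
qed (use assms in auto)

end

section \<open>Tail bounds for regular graphs and triple systems\<close>

text \<open>A vertex completes at most as many edges as its degree \<open>r\<close>, so the
  increments are bounded for every set and no bad sets occur.\<close>

lemma graph_block_dev_tail:
  assumes "block_design V F 1 r" "r > 0" "i \<le> card V" "a \<ge> 0"
  shows "subset_mean V i (indicator {B. \<bar>inner_blocks F B - block_mean (card V) 1 r i\<bar> > a})
    \<le> 2 * exp (- (2 * a\<^sup>2 / (i * (real r)\<^sup>2)))"
proof -
  interpret block_design V F 1 r by fact
  have lk: "inner_blocks (link F x) B \<in> {0..r}" if "x \<in> V" for x B
  proof -
    interpret L: block_design "V - {x}" "link F x" 0 r using that by (intro link_design) auto
    \<comment> \<open>For \<open>k = 0\<close> the codegree of the empty set is the total number of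
      blocks.\<close>
    have "card {P \<in> link F x. P \<subseteq> B} \<le> card {P \<in> link F x. {} \<subseteq> P}"
      using L.finite_F by (intro card_mono) auto
    also have "\<dots> = r" by (rule L.codegree) auto
    finally show ?thesis by (simp add: inner_blocks_def)
  qed
  have "subset_mean V i (indicator {B. \<bar>block_dev B\<bar> > a})
    \<le> 2 * exp (- (2 * a\<^sup>2 / (i * (real r)\<^sup>2))) + (\<Sum>j<i. subset_mean V j (indicator {}))"
  proof (rule block_dev_tail)
    fix B x y assume "x \<in> V - B" "y \<in> V - B"
    then show "inner_blocks (link F x) B - inner_blocks (link F y) B \<le> r"
      using lk[of x B] lk[of y B] by auto
  qed (use assms in auto)
  moreover have "subset_mean V i (indicator {B. \<bar>block_dev B\<bar> > a}) =
     subset_mean V i (indicator {B. \<bar>inner_blocks F B - block_mean (card V) 1 r i\<bar> > a})"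
    by (intro subset_mean_cong) (simp only: block_dev_def indicator_def mem_Collect_eq)
  moreover have "subset_mean V j (indicator {}) = 0" for j by (simp add: subset_mean_def)
  ultimately show ?thesis by simp
qed

text \<open>The link of \<open>x\<close> lives on \<open>V - {x}\<close>, while the process runs in
  \<open>V\<close>. Both sums range over the same sets; the right-hand one is divided by the smaller
  binomial.\<close>

lemma subset_mean_avoid_le:
  assumes "finite V" "x \<in> V" "i < card V"
  shows "subset_mean V i (indicator {B. x \<notin> B \<and> B \<in> E}) \<le> subset_mean (V - {x}) i (indicator E)"
proof -
  have "(\<Sum>B | B \<subseteq> V \<and> card B = i. indicator {B. x \<notin> B \<and> B \<in> E} B :: real) =
     (\<Sum>B | B \<subseteq> V - {x} \<and> card B = i. indicator E B)"
    using assms(1) by (intro sum.mono_neutral_cong_right) (auto simp: indicator_def)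
  moreover have "real (card (V - {x}) choose i) \<le> real (card V choose i)"
    using assms by (intro of_nat_mono binomial_right_mono) (auto intro: card_mono)
  moreover have "real (card (V - {x}) choose i) > 0" "real (card V choose i) > 0"
    using assms by (simp_all add: zero_less_binomial_iff)
  ultimately show ?thesis unfolding subset_mean_def
    by (simp only:) (intro divide_left_mono sum_nonneg mult_pos_pos; simp)
qed

lemma triple_block_dev_tail:
  assumes "block_design V F 2 r" "r > 0" "i < card V" "t > 0" "a \<ge> 0"
  shows "subset_mean V i (indicator {B. \<bar>inner_blocks F B - block_mean (card V) 2 r i\<bar> > a})
    \<le> 2 * exp (- (2 * a\<^sup>2 / (i * (2 * t)\<^sup>2)))
      + real (i * card V) * (2 * exp (- (2 * t\<^sup>2 / (i * (real r)\<^sup>2))))"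
proof -
  interpret block_design V F 2 r by fact
  \<comment> \<open>All links share the parameters on \<open>card V - 1\<close> points, hence this
    common mean; two link counts within \<open>t\<close> of it differ by at most
    \<open>2 * t\<close>.\<close>
  let ?m = "\<lambda>B. block_mean (card V - 1) 1 r (card B)"
  let ?E = "\<lambda>x. {B. \<bar>inner_blocks (link F x) B - ?m B\<bar> > t}"
  let ?q = "2 * exp (- (2 * t\<^sup>2 / (i * (real r)\<^sup>2)))"
  \<comment> \<open>Only candidates outside \<open>B\<close> matter, and for these \<open>B\<close>
    is a subset of the vertex set \<open>V - {x}\<close> of the link graph.\<close>
  define bad where "bad = {B. \<exists>x\<in>V. x \<notin> B \<and> B \<in> ?E x}"
  have bad: "subset_mean V j (indicator bad) \<le> real (card V) * ?q" if j: "j < i" for j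
  proof -
    have "subset_mean V j (indicator bad) \<le> subset_mean V j (\<lambda>B. \<Sum>x\<in>V. indicator {B. x \<notin> B \<and> B \<in> ?E x} B)"
    proof (rule subset_mean_mono)
      fix B
      show "indicator bad B \<le> (\<Sum>x\<in>V. indicator {B. x \<notin> B \<and> B \<in> ?E x} B :: real)"
      proof (cases "B \<in> bad")
        case True
        then obtain x where x: "x \<in> V" "B \<in> {B. x \<notin> B \<and> B \<in> ?E x}" by (auto simp: bad_def)
        then have "(1::real) = indicator {B. x \<notin> B \<and> B \<in> ?E x} B" by simp
        also have "\<dots> \<le> (\<Sum>x\<in>V. indicator {B. x \<notin> B \<and> B \<in> ?E x} B)"
          using finite_V x(1) by (intro member_le_sum) auto
        finally show ?thesis using True by simp
      qed (auto intro: sum_nonneg)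
    qed
    also have "\<dots> = (\<Sum>x\<in>V. subset_mean V j (indicator {B. x \<notin> B \<and> B \<in> ?E x}))"
      by (rule subset_mean_sum)
    also have "\<dots> \<le> (\<Sum>x\<in>V. ?q)"
    proof (rule sum_mono)
      fix x assume x: "x \<in> V"
      then have L: "block_design (V - {x}) (link F x) 1 r" by (intro link_design) auto
      have c: "card (V - {x}) = card V - 1" using x by simp
      have "subset_mean V j (indicator {B. x \<notin> B \<and> B \<in> ?E x}) \<le> subset_mean (V - {x}) j (indicator (?E x))"
        using finite_V x j assms(3) by (intro subset_mean_avoid_le) auto
      \<comment> \<open>At \<open>j = 0\<close> the graph bound would degenerate to 2 through
        division by zero, but the empty set has deviation exactly 0. For \<open>j > 0\<close> the
        bound grows with \<open>j\<close>, so \<open>j\<close> may be replaced by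
        \<open>i\<close>.\<close>
      also have "\<dots> \<le> ?q"
      proof (cases "j = 0")
        case True
        then show ?thesis
          using block_design.inner_blocks_empty[OF L] finite_V assms(4) by (simp add: subset_mean_0)
      next
        case False
        have "subset_mean (V - {x}) j (indicator (?E x)) =
            subset_mean (V - {x}) j (indicator {B. \<bar>inner_blocks (link F x) B - block_mean (card (V - {x})) 1 r j\<bar> > t})"
          by (intro subset_mean_cong) (simp add: indicator_def c)
        also have "\<dots> \<le> 2 * exp (- (2 * t\<^sup>2 / (j * (real r)\<^sup>2)))"
          using L assms j x by (intro graph_block_dev_tail) auto
        also have "\<dots> \<le> ?q"
          using False j assms(2) by (auto intro!: divide_left_mono mult_right_mono mult_pos_pos)
        finally show ?thesis .
      qed
      finally show "subset_mean V j (indicator {B. x \<notin> B \<and> B \<in> ?E x}) \<le> ?q" .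
    qed
    finally show ?thesis by simp
  qed
  have "subset_mean V i (indicator {B. \<bar>block_dev B\<bar> > a})
    \<le> 2 * exp (- (2 * a\<^sup>2 / (i * (2 * t)\<^sup>2))) + (\<Sum>j<i. subset_mean V j (indicator bad))"
  proof (rule block_dev_tail)
    fix B x y assume "B \<notin> bad" "x \<in> V - B" "y \<in> V - B"
    then have "\<bar>inner_blocks (link F x) B - ?m B\<bar> \<le> t" "\<bar>inner_blocks (link F y) B - ?m B\<bar> \<le> t"
      by (auto simp: bad_def not_less)
    then show "inner_blocks (link F x) B - inner_blocks (link F y) B \<le> 2 * t" by linarith
  qed (use assms in auto)
  also have "(\<Sum>j<i. subset_mean V j (indicator bad)) \<le> (\<Sum>j<i. real (card V) * ?q)"
    using bad by (intro sum_mono) auto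
  also have "subset_mean V i (indicator {B. \<bar>block_dev B\<bar> > a}) =
       subset_mean V i (indicator {B. \<bar>inner_blocks F B - block_mean (card V) 2 r i\<bar> > a})"
    by (intro subset_mean_cong) (simp add: block_dev_def indicator_def)
  finally show ?thesis by (simp add: mult.assoc)
qed

section \<open>Three-term progressions\<close>

text \<open>Replaces the half range of differences by a congruence symmetric in the two end points.
  A difference above \<open>(N - 1) div 2\<close> is brought into range by reading the progression
  backwards.\<close>

lemma three_progressions_iff:
  assumes "prime N" "N > 2"
  shows "P \<in> three_progressions N \<longleftrightarrow>
    (\<exists>u v w. P = {u, v, w} \<and> u < N \<and> v < N \<and> w < N \<and> u \<noteq> v \<and> int N dvd int u + int w - 2 * int v)"
proof
  assume "P \<in> three_progressions N"
  then obtain x d where P: "P = {x, (x + d) mod N, (x + 2 * d) mod N}" "x < N" "1 \<le> d" "d \<le> (N - 1) div 2"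
    by (auto simp: three_progressions_def)
  have "x \<noteq> (x + d) mod N"
  proof
    assume "x = (x + d) mod N"
    then have "(x + d) mod N = x mod N" using P(2) by simp
    then have "N dvd d" by (simp add: mod_eq_dvd_iff_nat)
    moreover have "d < N" "d > 0" using P assms by auto
    ultimately show False using nat_dvd_not_less by blast
  qed
  moreover have "int N dvd int x + int ((x + 2 * d) mod N) - 2 * int ((x + d) mod N)"
  proof -
    have *: "int (t mod N) = int t - int N * int (t div N)" for t
      by (simp add: zmod_int zdiv_int minus_mult_div_eq_mod)
    have "int x + int ((x + 2 * d) mod N) - 2 * int ((x + d) mod N)
      = int N * (2 * int ((x + d) div N) - int ((x + 2 * d) div N))"
      unfolding * by (simp add: algebra_simps del: div_mult_self1 div_mult_self2)
    then show ?thesis by simp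
  qed
  ultimately show "\<exists>u v w. P = {u, v, w} \<and> u < N \<and> v < N \<and> w < N \<and> u \<noteq> v \<and> int N dvd int u + int w - 2 * int v"
    using P(1,2) mod_less_divisor[of N] assms(2) by (metis gr_zeroI not_less_zero)
next
  have key: "{u, v, w} \<in> three_progressions N"
    if uvw: "u < N" "v < N" "w < N" "int N dvd int u + int w - 2 * int v"
      and d: "(int v - int u) mod int N = int d" "1 \<le> d" "d \<le> (N - 1) div 2" for u v w d
  proof -
    have 1: "(u + d) mod N = v"
    proof -
      have "int ((u + d) mod N) = (int u + (int v - int u) mod int N) mod int N"
        by (simp add: d(1) zmod_int)
      also have "\<dots> = int v" using uvw by (simp add: mod_simps)
      finally show ?thesis by simp
    qed
    have 2: "(u + 2 * d) mod N = w"
    proof -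
      have "int ((u + 2 * d) mod N) = (int u + 2 * ((int v - int u) mod int N)) mod int N"
        by (simp add: d(1) zmod_int)
      also have "\<dots> = (int u + 2 * (int v - int u)) mod int N" by (metis mod_add_right_eq mod_mult_right_eq)
      also have "\<dots> = (2 * int v - int u) mod int N" by (simp add: algebra_simps)
      also have "\<dots> = int w mod int N"
        using uvw(4) by (simp add: mod_eq_dvd_iff dvd_diff_commute algebra_simps)
      also have "\<dots> = int w" using uvw by simp
      finally show ?thesis by simp
    qed
    show ?thesis unfolding three_progressions_def
      using 1 2 uvw(1) d(2,3) by (intro CollectI exI[of _ u] exI[of _ d]) auto
  qed
  assume "\<exists>u v w. P = {u, v, w} \<and> u < N \<and> v < N \<and> w < N \<and> u \<noteq> v \<and> int N dvd int u + int w - 2 * int v"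
  then obtain u v w where P: "P = {u, v, w}" "u < N" "v < N" "w < N" "u \<noteq> v" and dv: "int N dvd int u + int w - 2 * int v"
    by blast
  define e where "e = (int v - int u) mod int N"
  have e: "0 \<le> e" "e < int N" using assms by (simp_all add: e_def)
  have "e \<noteq> 0"
  proof
    assume "e = 0"
    then have "int v mod int N = int u mod int N" by (simp add: e_def mod_eq_dvd_iff dvd_eq_mod_eq_0)
    then show False using P by simp
  qed
  have "odd N" using assms prime_odd_nat by blast
  show "P \<in> three_progressions N"
  proof (cases "nat e \<le> (N - 1) div 2")
    case True
    have "1 \<le> nat e" using e \<open>e \<noteq> 0\<close> by linarith
    moreover have "(int v - int u) mod int N = int (nat e)" using e by (simp add: e_def)
    ultimately show ?thesis using key[of u v w "nat e"] P dv True by blast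
  next
    case False
    \<comment> \<open>The reversed progression has difference \<open>N - e\<close>, which is at most
      \<open>(N - 1) div 2\<close> because \<open>N\<close> is odd.\<close>
    have "(int v - int w) mod int N = (- (int v - int u)) mod int N"
      using dv by (simp add: mod_eq_dvd_iff dvd_diff_commute algebra_simps)
    also have "\<dots> = int N - e"
      using \<open>e \<noteq> 0\<close> unfolding e_def by (subst zmod_zminus1_eq_if) auto
    finally have "(int v - int w) mod int N = int (N - nat e)" using e by simp
    then have "{w, v, u} \<in> three_progressions N"
      using False \<open>odd N\<close> e \<open>e \<noteq> 0\<close> P dv by (intro key[of w v u "N - nat e"]) (auto simp: add.commute elim!: oddE)
    then show ?thesis using P(1) by (simp add: insert_commute)
  qed
qed

text \<open>Two residues \<open>x\<close>, \<open>y\<close> are completed by the reflections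
  \<open>2x - y\<close> and \<open>2y - x\<close> or by the midpoint. These are distinct from each
  other and from \<open>x\<close>, \<open>y\<close> because 2 and 3 are invertible modulo a prime
  above 3.\<close>

lemma three_progressions_design:
  assumes "prime N" "N > 3"
  shows "block_design {0..<N} (three_progressions N) 2 3"
proof
  show "finite {0..<N}" by simp
next
  have "N > 2" using assms by simp
  note iff = three_progressions_iff[OF assms(1) this]
  have pN: "prime (int N)" using assms by simp
  have small: "x = y" if "int N dvd int x - int y" "x < N" "y < N" for x y
  proof -
    have "int x mod int N = int y mod int N" using that(1) by (simp add: mod_eq_dvd_iff)
    then show ?thesis using that by simp
  qed
  have c2: "x = y" if "int N dvd 2 * (int x - int y)" "x < N" "y < N" for x y
  proof -
    have "\<not> int N dvd 2" using assms zdvd_not_zless[of 2 "int N"] by simp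
    then show ?thesis using that pN small prime_dvd_mult_iff by blast
  qed
  have c3: "x = y" if "int N dvd 3 * (int x - int y)" "x < N" "y < N" for x y
  proof -
    have "\<not> int N dvd 3" using assms zdvd_not_zless[of 3 "int N"] by simp
    then show ?thesis using that pN small prime_dvd_mult_iff by blast
  qed
  {
    fix P assume "P \<in> three_progressions N"
    then obtain u v w where P: "P = {u, v, w}" "u < N" "v < N" "w < N" "u \<noteq> v"
      and dv: "int N dvd int u + int w - 2 * int v" unfolding iff by blast
    have "w \<noteq> v" using dv P small[of u v] by auto
    moreover have "w \<noteq> u" using dv P c2[of u v] by auto
    ultimately show "P \<subseteq> {0..<N} \<and> card P = Suc 2" using P by auto
  }
  fix S :: "nat set" assume S: "S \<subseteq> {0..<N}" "card S = 2"
  then obtain x y where xy: "S = {x, y}" "x \<noteq> y" by (auto simp: card_2_iff)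
  then have xyN: "x < N" "y < N" using S by auto
  \<comment> \<open>\<open>h\<close> is the inverse of 2 modulo \<open>N\<close>, so
    \<open>z3\<close> below is the midpoint of \<open>x\<close> and \<open>y\<close>.\<close>
  define h where "h = int (N + 1) div 2"
  have "odd N" using assms prime_odd_nat by force
  then have h: "2 * h = int N + 1" unfolding h_def by (auto elim!: oddE)
  define z1 z2 z3 where "z1 = nat ((2 * int x - int y) mod int N)"
    and "z2 = nat ((2 * int y - int x) mod int N)" and "z3 = nat (((int x + int y) * h) mod int N)"
  have ex: "nat (t mod int N) < N \<and> int N dvd int (nat (t mod int N)) - t" for t
    using assms by (simp add: nat_less_iff mod_eq_dvd_iff[symmetric])
  have z1: "z1 < N" "int N dvd int z1 - (2 * int x - int y)"
    and z2: "z2 < N" "int N dvd int z2 - (2 * int y - int x)"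
    and z3: "z3 < N" "int N dvd int z3 - (int x + int y) * h"
    using ex by (auto simp: z1_def z2_def z3_def)
  have z3': "int N dvd 2 * int z3 - (int x + int y)"
  proof -
    have "2 * int z3 - (int x + int y) = 2 * (int z3 - (int x + int y) * h) + int N * (int x + int y)"
      using h by algebra
    then show ?thesis by (simp only:) (rule dvd_add[OF dvd_mult[OF z3(2)] dvd_triv_left])
  qed
  have uniq: "z = z'" if "int N dvd int z - t" "int N dvd int z' - t" "z < N" "z' < N" for z z' t
    using dvd_diff[OF that(1,2)] small that(3,4) by simp
  have n1: "z1 \<noteq> x" using z1(2) small[of y x] xy xyN by (auto simp: algebra_simps)
  have n1': "z1 \<noteq> y" using z1(2) c2[of y x] xy xyN by (auto simp: algebra_simps)
  have n2: "z2 \<noteq> y" using z2(2) small[of x y] xy xyN by (auto simp: algebra_simps)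
  have n2': "z2 \<noteq> x" using z2(2) c2[of x y] xy xyN by (auto simp: algebra_simps)
  have n3: "z3 \<noteq> x" using z3' small[of x y] xy xyN by (auto simp: algebra_simps)
  have n3': "z3 \<noteq> y" using z3' small[of y x] xy xyN by (auto simp: algebra_simps)
  have n12: "z1 \<noteq> z2"
    using dvd_diff[OF z2(2) z1(2)] c3[of x y] xy xyN by (auto simp: algebra_simps)
  have n13: "z1 \<noteq> z3"
  proof
    assume "z1 = z3"
    then have "int N dvd (2 * int z3 - (int x + int y)) - 2 * (int z3 - (2 * int x - int y))"
      using dvd_diff[OF z3' dvd_mult[OF z1(2), of 2]] by (simp only:)
    then show False using c3[of x y] xy xyN by (auto simp: algebra_simps)
  qed
  have n23: "z2 \<noteq> z3"
  proof
    assume "z2 = z3"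
    then have "int N dvd (2 * int z3 - (int x + int y)) - 2 * (int z3 - (2 * int y - int x))"
      using dvd_diff[OF z3' dvd_mult[OF z2(2), of 2]] by (simp only:)
    then show False using c3[of y x] xy xyN by (auto simp: algebra_simps)
  qed
  have third: "z \<in> {z1, z2, z3}"
    if "z < N" "int N dvd int x + int y - 2 * int z \<or> int N dvd int x + int z - 2 * int y \<or> int N dvd int y + int z - 2 * int x" for z
    using that(2)
  proof (elim disjE)
    assume "int N dvd int x + int y - 2 * int z"
    from dvd_add[OF this z3'] have "int N dvd 2 * (int z3 - int z)" by (simp add: algebra_simps)
    then show ?thesis using c2 z3(1) that(1) by blast
  next
    assume "int N dvd int x + int z - 2 * int y"
    then have "int N dvd int z - (2 * int y - int x)" by (simp add: algebra_simps)
    then show ?thesis using uniq z2 that(1) by blast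
  next
    assume "int N dvd int y + int z - 2 * int x"
    then have "int N dvd int z - (2 * int x - int y)" by (simp add: algebra_simps)
    then show ?thesis using uniq z1 that(1) by blast
  qed
  have "{P \<in> three_progressions N. S \<subseteq> P} = (\<lambda>z. {x, y, z}) ` {z1, z2, z3}"
  proof (intro equalityI subsetI)
    fix P assume "P \<in> {P \<in> three_progressions N. S \<subseteq> P}"
    then obtain u v w where P: "P = {u, v, w}" "u < N" "v < N" "w < N" "u \<noteq> v"
      and dv: "int N dvd int u + int w - 2 * int v" and "x \<in> P" "y \<in> P" unfolding iff using xy by blast
    then consider "x = u" "y = v" | "x = u" "y = w" | "x = v" "y = u" | "x = v" "y = w" | "x = w" "y = u" | "x = w" "y = v"
      using xy(2) by auto
    then have "\<exists>z\<in>{z1, z2, z3}. P = {x, y, z}"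
    proof cases
      case 1 then show ?thesis using third[of w] P dv by (intro bexI[of _ w]) auto
    next
      case 2 then show ?thesis using third[of v] P dv by (intro bexI[of _ v]) auto
    next
      case 3 then show ?thesis using third[of w] P dv by (intro bexI[of _ w]) auto
    next
      case 4 then show ?thesis using third[of u] P dv by (intro bexI[of _ u]) (auto simp: add.commute)
    next
      case 5 then show ?thesis using third[of v] P dv by (intro bexI[of _ v]) (auto simp: add.commute)
    next
      case 6 then show ?thesis using third[of u] P dv by (intro bexI[of _ u]) (auto simp: add.commute)
    qed
    then show "P \<in> (\<lambda>z. {x, y, z}) ` {z1, z2, z3}" by blast
  next
    fix P assume "P \<in> (\<lambda>z. {x, y, z}) ` {z1, z2, z3}"
    \<comment> \<open>Each set is listed with its middle term second, as the characterisation of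
      progressions requires.\<close>
    then consider "P = {y, x, z1}" | "P = {x, y, z2}" | "P = {x, z3, y}" by auto
    then have "P \<in> three_progressions N"
    proof cases
      case 1
      have "int N dvd int y + int z1 - 2 * int x" using z1(2) by (simp add: algebra_simps)
      then show ?thesis unfolding iff using 1 xy xyN z1(1) by blast
    next
      case 2
      have "int N dvd int x + int z2 - 2 * int y" using z2(2) by (simp add: algebra_simps)
      then show ?thesis unfolding iff using 2 xy xyN z2(1) by blast
    next
      case 3
      have "int N dvd int x + int y - 2 * int z3" using z3' by (subst dvd_diff_commute) simp
      then show ?thesis unfolding iff using 3 n3 xyN z3(1) by blast
    qed
    moreover have "S \<subseteq> P" using \<open>P \<in> _ ` _\<close> xy by auto
    ultimately show "P \<in> {P \<in> three_progressions N. S \<subseteq> P}" by blast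
  qed
  moreover have "inj_on (\<lambda>z. {x, y, z}) {z1, z2, z3}"
  proof (rule inj_onI)
    fix z z' assume "z \<in> {z1, z2, z3}" "z' \<in> {z1, z2, z3}" and eq: "{x, y, z} = {x, y, z'}"
    then have "z \<noteq> x" "z \<noteq> y" using n1 n1' n2 n2' n3 n3' by auto
    then show "z = z'" using eq by auto
  qed
  ultimately show "card {P \<in> three_progressions N. S \<subseteq> P} = 3"
    using n12 n13 n23 by (simp add: card_image)
qed

section \<open>Degenerate cases and the final bound\<close>

text \<open>Here the count is constant on \<open>m\<close>-subsets: for \<open>m = N\<close> there
  is only one such set, and for \<open>N <= 3\<close> with \<open>m < N\<close> no progression fits.
  This settles what the design (\<open>N > 3\<close>) and the tail bound (\<open>m < N\<close>)
  leave out.\<close>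

lemma D3_eq_0:
  assumes "m \<le> N" "N \<le> 3 \<or> m = N" "prime N" "B \<subseteq> {0..<N}" "card B = m"
  shows "D3 N m B = 0"
proof -
  have const: "N3 N B = N3 N B'" if "B' \<subseteq> {0..<N}" "card B' = m" for B'
  proof (cases "m = N")
    case True
    then have "B' = {0..<N}" "B = {0..<N}" using that assms card_subset_eq[of "{0..<N}"] by simp_all
    then show ?thesis by simp
  next
    case False
    then have "N = 2 \<or> N = 3" using assms prime_ge_2_nat[of N] by auto
    then have big: "card P \<ge> N" if P: "P \<in> three_progressions N" for P
    proof
      assume "N = 3"
      then obtain x where "x < 3" "P = {x, (x + 1) mod 3, (x + 2) mod 3}"
        using P by (auto simp: three_progressions_def)
      moreover have "x \<in> {0, 1, 2}" using \<open>x < 3\<close> by auto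
      ultimately show ?thesis using \<open>N = 3\<close> by auto
    qed (use P in \<open>auto simp: three_progressions_def\<close>)
    have "N3 N C = 0" if C: "C \<subseteq> {0..<N}" "card C = m" for C
    proof -
      have "finite C" using C(1) finite_subset by blast
      then have "\<not> P \<subseteq> C" if "P \<in> three_progressions N" for P
        using big[OF that] card_mono[of C P] C(2) False assms(1) by linarith
      then have "{P \<in> three_progressions N. P \<subseteq> C} = {}" by blast
      then show ?thesis unfolding N3_def by (simp only: card.empty)
    qed
    then show ?thesis using that assms(4,5) by simp
  qed
  have "measure_pmf.expectation (random_subset N m) (\<lambda>B'. real (N3 N B')) = subset_mean {0..<N} m (\<lambda>B'. real (N3 N B'))"
    unfolding random_subset_def using assms(1) by (subst expectation_uniform_subset) auto
  also have "\<dots> = subset_mean {0..<N} m (\<lambda>_. real (N3 N B))"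
    by (intro subset_mean_cong) (use const in auto)
  also have "\<dots> = real (N3 N B)" using assms(1) by (simp add: subset_mean_const)
  finally show ?thesis by (simp add: D3_def)
qed

theorem theorem5p2:
  fixes N m :: nat and a :: real
  assumes "prime N" and "1 \<le> m" and "m \<le> N" and "a > 0"
  shows "measure_pmf.prob (random_subset N m) {B. \<bar>D3 N m B\<bar> > a}
           \<le> (real N * real m + 1) * exp (- (a / (9 * real m)))"
proof -
  let ?V = "{0..<N}"
  have "measure_pmf.prob (random_subset N m) {B. \<bar>D3 N m B\<bar> > a}
      = measure_pmf.expectation (random_subset N m) (indicator {B. \<bar>D3 N m B\<bar> > a})"
    by simp
  also have "\<dots> = subset_mean ?V m (indicator {B. \<bar>D3 N m B\<bar> > a})"
    unfolding random_subset_def using assms(3) by (subst expectation_uniform_subset) auto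
  finally have P: "measure_pmf.prob (random_subset N m) {B. \<bar>D3 N m B\<bar> > a}
      = subset_mean ?V m (indicator {B. \<bar>D3 N m B\<bar> > a})" .
  define q where "q = exp (- (a / (9 * real m)))"
  have q0: "q > 0" by (simp add: q_def)
  show ?thesis
  proof (cases "N \<le> 3 \<or> m = N")
    case True
    then have "subset_mean ?V m (indicator {B. \<bar>D3 N m B\<bar> > a}) = subset_mean ?V m (\<lambda>_. 0)"
      using assms by (intro subset_mean_cong) (auto simp: D3_eq_0)
    also have "\<dots> = 0" by (simp add: subset_mean_def)
    finally show ?thesis unfolding P by simp
  next
    case False
    then have N: "N > 3" and mN: "m < N" using assms by auto
    interpret block_design ?V "three_progressions N" 2 3
      by (rule three_progressions_design[OF assms(1) N])
    have inner: "real (N3 N B) = inner_blocks (three_progressions N) B" for B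
      by (simp add: N3_def inner_blocks_def)
    have "measure_pmf.expectation (random_subset N m) (\<lambda>B. real (N3 N B)) = block_mean N 2 3 m"
      unfolding random_subset_def inner using assms(3) subset_mean_inner_blocks[of m]
      by (subst expectation_uniform_subset) auto
    then have D: "D3 N m B = inner_blocks (three_progressions N) B - block_mean N 2 3 m" for B
      by (simp add: D3_def inner)
    show ?thesis
    proof (cases "(real N * real m + 1) * q \<ge> 1")
      case True
      have "measure_pmf.prob (random_subset N m) {B. \<bar>D3 N m B\<bar> > a} \<le> 1" by (rule measure_pmf.prob_le_1)
      then show ?thesis using True unfolding q_def by linarith
    next
      case False
      \<comment> \<open>The prefactor is at least 2 and the claimed bound is below 1, so
        \<open>q <= 1/2\<close>; one factor of \<open>q * q\<close> then pays for the 2.\<close>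
      have "real N * real m \<ge> 1 * 1" using N assms(2) by (intro mult_mono) auto
      then have "2 * q \<le> (real N * real m + 1) * q" using q0 by (intro mult_right_mono) auto
      then have "2 * q \<le> 1" using False by linarith
      then have q2: "2 * (q * q) \<le> q" using q0 by simp
      have qq: "q * q = exp (- (2 * a / (9 * real m)))" by (simp add: q_def exp_add[symmetric])
      \<comment> \<open>The choice \<open>t = sqrt a\<close> makes both exponents multiples of
        \<open>a / m\<close>, namely 1/2 and 2/9 of it.\<close>
      have "subset_mean ?V m (indicator {B. \<bar>D3 N m B\<bar> > a})
        \<le> 2 * exp (- (2 * a\<^sup>2 / (m * (2 * sqrt a)\<^sup>2)))
          + real (m * card ?V) * (2 * exp (- (2 * (sqrt a)\<^sup>2 / (m * (real 3)\<^sup>2))))"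
        using triple_block_dev_tail[OF block_design_axioms, of m "sqrt a" a] mN assms(4) by (simp add: D)
      also have "2 * a\<^sup>2 / (m * (2 * sqrt a)\<^sup>2) = a / (2 * real m)"
        using assms by (simp add: power2_eq_square field_simps)
      also have "2 * (sqrt a)\<^sup>2 / (m * (real 3)\<^sup>2) = 2 * a / (9 * real m)"
        using assms by (simp add: field_simps)
      \<comment> \<open>Since 1/2 exceeds 2/9, the main term is also bounded by
        \<open>q * q\<close>.\<close>
      also have "exp (- (a / (2 * real m))) \<le> q * q"
        unfolding qq using assms by (simp add: field_simps)
      also have "2 * (q * q) + real (m * card ?V) * (2 * exp (- (2 * a / (9 * real m)))) = (real N * real m + 1) * (2 * (q * q))"
        by (simp add: qq algebra_simps)
      also have "\<dots> \<le> (real N * real m + 1) * q"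
        using q2 by (intro mult_left_mono) auto
      finally show ?thesis unfolding P q_def by simp
    qed
  qed
qed

end
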